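(* Let $\sigma$ be a finite signature, and let $F$ be a fuzzy formula of $\sigma$ that may contain strong negation (in front of atoms), whose only fuzzy negation operator is $\neg_s(x)=1-x$. Let $\sigma'=\sigma\cup\{np\mid p\in\sigma\}$. (a) A valuation $V$ of $\sigma$ is a fuzzy equilibrium model of $F$ if and only if $V(h,p)=V(t,p)$ for all atoms $p\in\sigma$ and $\mathsf{I}_{nneg(V)}$ is a stable model of $nneg(F)$ relative to $\sigma'$. (b) An interpretation $I$ of $\sigma'$ is a stable model of $nneg(F)$ relative to $\sigma'$ if and only if $I=\mathsf{I}_{nneg(V)}$ for some fuzzy equilibrium model $V$ of $F$.
   Context: Fuzzy formulas. A signature $\sigma$ is a set of symbols (fuzzy atoms). Fuzzy formulas are built from atoms of $\sigma$ and numeric constants $c\in[0,1]$ using the fuzzy negation $\neg=\neg_s$, $\neg_s(x)=1-x$, fuzzy conjunctions $\otimes$, disjunctions $\oplus$ and implications $\rightarrow$ (several different ones may occur), identified with functions $[0,1]^2\to[0,1]$ such that (monotonicity being non-strict): $\otimes$ is increasing in both arguments, commutative, associative, $\otimes(1,x)=x$; $\oplus$ is increasing in both arguments, commutative, associative, $\oplus(0,x)=x$; $\rightarrow$ is decreasing in its first and increasing in its second argument, $\rightarrow\!(1,x)=x$, $\rightarrow\!(0,0)=1$. Formulas with strong negation may additionally contain subformulas $\sim\! a$ with $a$ an atom. $\otimes_m(x,y)=\min(x,y)$, $\otimes_l(x,y)=\max(x+y-1,0)$. Infix notation is used for values as well. Stable models (formulas without strong negation, signature $\tau$). An interpretation is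 a map $I:\tau\to[0,1]$; $\upsilon_I(p)=I(p)$, $\upsilon_I(c)=c$, $\upsilon_I(\neg F)=1-\upsilon_I(F)$, $\upsilon_I(F\odot G)=\upsilon_I(F)\odot\upsilon_I(G)$; $I\models F$ means $\upsilon_I(F)=1$. Reduct: $F^I=F$ for atoms and constants; $(\neg F)^I=\upsilon_I(\neg F)$; $(F\odot G)^I=(F^I\odot G^I)\otimes_m\upsilon_I(F\odot G)$ for $\odot\in\{\otimes,\oplus,\rightarrow\}$. $I$ is a stable model of $F$ relative to $\tau$ if $I\models F$ and there is no interpretation $J\neq I$ with $J(p)\le I(p)$ for all $p\in\tau$ and $J\models F^I$. Fuzzy equilibrium logic. A (fuzzy N5) valuation $V$ of $\sigma$ maps $\{h,t\}\times\sigma$ to closed subintervals of $[0,1]$ with $V(t,a)\subseteq V(h,a)$ for each $a\in\sigma$. $V^-$ and $V^+$ denote lower and upper bounds of the interval. $V$ is extended to formulas ($w\in\{h,t\}$) by: $V(w,c)=[c,c]$; $V(w,\sim\! a)=[1-V^+(w,a),\,1-V^-(w,a)]$; $V(w,F\odot G)=[V^-(w,F)\odot V^-(w,G),\,V^+(w,F)\odot V^+(w,G)]$ for $\odot\in\{\otimes,\oplus\}$; $V(h,\neg F)=[1-V^-(t,F),\,1-V^-(h,F)]$; $V(t,\neg F)=[1-V^-(t,F),\,1-V^-(t,F)]$; $V(h,F\rightarrow G)=[\min(V^-(h,F)\rightarrow V^-(h,G),\,V^-(t,F)\rightarrow V^-(t,G)),\ V^-(h,F)\rightarrow V^+(h,G)]$;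 $V(t,F\rightarrow G)=[V^-(t,F)\rightarrow V^-(t,G),\,V^-(t,F)\rightarrow V^+(t,G)]$. $V$ is a model of $F$ if $V^-(h,F)=1$. $V'\preceq V$ means $V'(t,a)=V(t,a)$ and $V(h,a)\subseteq V'(h,a)$ for all atoms $a$; $V'\prec V$ means $V'\preceq V$ and $V'\ne V$. A model $V$ of $F$ is h-minimal if there is no model $V'$ of $F$ with $V'\prec V$. A fuzzy equilibrium model of $F$ is an h-minimal model $V$ of $F$ with $V(h,a)=V(t,a)$ for all atoms $a$. Elimination of strong negation. For each $p\in\sigma$, $np$ is a new atom. $F'$ is obtained from $F$ by replacing every strongly negated atom $\sim\! p$ with $np$, and $nneg(F)=F'\otimes_m\bigotimes_{m,\,p\in\sigma}\neg_s(p\otimes_l np)$ (the second part is the $\otimes_m$-conjunction over all $p\in\sigma$). For a valuation $V$ of $\sigma$, $nneg(V)$ is the valuation of $\sigma\cup\{np\mid p\in\sigma\}$ with $nneg(V)(w,p)=[V^-(w,p),1]$ and $nneg(V)(w,np)=[1-V^+(w,p),1]$. For a valuation $V$ of a signature, $\mathsf{I}_V$ is the interpretation $\mathsf{I}_V(q)=V^-(h,q)$ for every atom $q$ of that signature. *)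

theory Defs
  imports Complex_Main "HOL-Library.FuncSet"
begin

section \<open>Fuzzy formulas\<close>

text \<open>
  Connectives are functions on the reals; only their restriction to the unit square matters.
\<close>

definition fuzzy_op :: "(real \<Rightarrow> real \<Rightarrow> real) \<Rightarrow> bool" where
  "fuzzy_op f \<longleftrightarrow> (\<forall>x\<in>{0..1}. \<forall>y\<in>{0..1}. f x y \<in> {0..1})"

definition fuzzy_conj :: "(real \<Rightarrow> real \<Rightarrow> real) \<Rightarrow> bool" where
  "fuzzy_conj f \<longleftrightarrow> fuzzy_op f \<and>
     (\<forall>y\<in>{0..1}. mono_on {0..1} (\<lambda>x. f x y)) \<and>
     (\<forall>x\<in>{0..1}. mono_on {0..1} (\<lambda>y. f x y)) \<and>
     (\<forall>x\<in>{0..1}. \<forall>y\<in>{0..1}. f x y = f y x) \<and>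
     (\<forall>x\<in>{0..1}. \<forall>y\<in>{0..1}. \<forall>z\<in>{0..1}. f (f x y) z = f x (f y z)) \<and>
     (\<forall>x\<in>{0..1}. f 1 x = x)"

definition fuzzy_disj :: "(real \<Rightarrow> real \<Rightarrow> real) \<Rightarrow> bool" where
  "fuzzy_disj f \<longleftrightarrow> fuzzy_op f \<and>
     (\<forall>y\<in>{0..1}. mono_on {0..1} (\<lambda>x. f x y)) \<and>
     (\<forall>x\<in>{0..1}. mono_on {0..1} (\<lambda>y. f x y)) \<and>
     (\<forall>x\<in>{0..1}. \<forall>y\<in>{0..1}. f x y = f y x) \<and>
     (\<forall>x\<in>{0..1}. \<forall>y\<in>{0..1}. \<forall>z\<in>{0..1}. f (f x y) z = f x (f y z)) \<and>
     (\<forall>x\<in>{0..1}. f 0 x = x)"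

definition fuzzy_impl :: "(real \<Rightarrow> real \<Rightarrow> real) \<Rightarrow> bool" where
  "fuzzy_impl f \<longleftrightarrow> fuzzy_op f \<and>
     (\<forall>y\<in>{0..1}. antimono_on {0..1} (\<lambda>x. f x y)) \<and>
     (\<forall>x\<in>{0..1}. mono_on {0..1} (\<lambda>y. f x y)) \<and>
     (\<forall>x\<in>{0..1}. f 1 x = x) \<and>
     f 0 0 = 1"

definition conj_m :: "real \<Rightarrow> real \<Rightarrow> real" where
  "conj_m x y = min x y"

definition conj_l :: "real \<Rightarrow> real \<Rightarrow> real" where
  "conj_l x y = max (x + y - 1) 0"

datatype 'a fform =
    Atom 'a
  | Const real
  | Neg "'a fform"
  | Conj "real \<Rightarrow> real \<Rightarrow> real" "'a fform" "'a fform"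
  | Disj "real \<Rightarrow> real \<Rightarrow> real" "'a fform" "'a fform"
  | Impl "real \<Rightarrow> real \<Rightarrow> real" "'a fform" "'a fform"

primrec fuzzy_formula :: "'a set \<Rightarrow> 'a fform \<Rightarrow> bool" where
  "fuzzy_formula \<tau> (Atom p) \<longleftrightarrow> p \<in> \<tau>"
| "fuzzy_formula \<tau> (Const c) \<longleftrightarrow> c \<in> {0..1}"
| "fuzzy_formula \<tau> (Neg F) \<longleftrightarrow> fuzzy_formula \<tau> F"
| "fuzzy_formula \<tau> (Conj f F G) \<longleftrightarrow> fuzzy_conj f \<and> fuzzy_formula \<tau> F \<and> fuzzy_formula \<tau> G"
| "fuzzy_formula \<tau> (Disj f F G) \<longleftrightarrow> fuzzy_disj f \<and> fuzzy_formula \<tau> F \<and> fuzzy_formula \<tau> G"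
| "fuzzy_formula \<tau> (Impl f F G) \<longleftrightarrow> fuzzy_impl f \<and> fuzzy_formula \<tau> F \<and> fuzzy_formula \<tau> G"

text \<open>
  Strong negation is applied to atoms only, so a formula with strong negation is a formula whose
  leaves are literals: \<open>Pos a\<close> is the atom \<open>a\<close>, and \<open>SNeg a\<close> is its strong negation.
\<close>

datatype 'a literal = Pos 'a | SNeg 'a

type_synonym 'a sform = "'a literal fform"

definition literals :: "'a set \<Rightarrow> 'a literal set" where
  "literals \<sigma> = Pos ` \<sigma> \<union> SNeg ` \<sigma>"


section \<open>Stable models\<close>

text \<open>
  Interpretations and valuations of a signature are extensional functions (equal to
  \<open>undefined\<close> outside the signature), so that HOL equality is equality on the signature.
\<close>

definition interpretations :: "'a set \<Rightarrow> ('a \<Rightarrow> real) set" where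
  "interpretations \<tau> = \<tau> \<rightarrow>\<^sub>E {0..1}"

primrec eval_form :: "('a \<Rightarrow> real) \<Rightarrow> 'a fform \<Rightarrow> real" where
  "eval_form I (Atom p) = I p"
| "eval_form I (Const c) = c"
| "eval_form I (Neg F) = 1 - eval_form I F"
| "eval_form I (Conj f F G) = f (eval_form I F) (eval_form I G)"
| "eval_form I (Disj f F G) = f (eval_form I F) (eval_form I G)"
| "eval_form I (Impl f F G) = f (eval_form I F) (eval_form I G)"

definition satisfies :: "('a \<Rightarrow> real) \<Rightarrow> 'a fform \<Rightarrow> bool" where
  "satisfies I F \<longleftrightarrow> eval_form I F = 1"

primrec reduct :: "('a \<Rightarrow> real) \<Rightarrow> 'a fform \<Rightarrow> 'a fform" where
  "reduct I (Atom p) = Atom p"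
| "reduct I (Const c) = Const c"
| "reduct I (Neg F) = Const (eval_form I (Neg F))"
| "reduct I (Conj f F G) =
     Conj conj_m (Conj f (reduct I F) (reduct I G)) (Const (eval_form I (Conj f F G)))"
| "reduct I (Disj f F G) =
     Conj conj_m (Disj f (reduct I F) (reduct I G)) (Const (eval_form I (Disj f F G)))"
| "reduct I (Impl f F G) =
     Conj conj_m (Impl f (reduct I F) (reduct I G)) (Const (eval_form I (Impl f F G)))"

definition stable_model :: "'a set \<Rightarrow> 'a fform \<Rightarrow> ('a \<Rightarrow> real) \<Rightarrow> bool" where
  "stable_model \<tau> F I \<longleftrightarrow> I \<in> interpretations \<tau> \<and> satisfies I F \<and>
     \<not> (\<exists>J \<in> interpretations \<tau>. J \<noteq> I \<and> (\<forall>p\<in>\<tau>. J p \<le> I p) \<and> satisfies J (reduct I F))"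


section \<open>Fuzzy equilibrium logic\<close>

datatype world = Here | There

type_synonym 'a valuation = "world \<Rightarrow> 'a \<Rightarrow> real set"

abbreviation lower_bd :: "real set \<Rightarrow> real" where
  "lower_bd A \<equiv> Inf A"

abbreviation upper_bd :: "real set \<Rightarrow> real" where
  "upper_bd A \<equiv> Sup A"

definition unit_intervals :: "real set set" where
  "unit_intervals = {{l..u} | l u. 0 \<le> l \<and> l \<le> u \<and> u \<le> 1}"

definition valuations :: "'a set \<Rightarrow> 'a valuation set" where
  "valuations \<sigma> =
     {V. (\<forall>w. V w \<in> \<sigma> \<rightarrow>\<^sub>E unit_intervals) \<and> (\<forall>a\<in>\<sigma>. V There a \<subseteq> V Here a)}"

fun val_lit :: "'a valuation \<Rightarrow> world \<Rightarrow> 'a literal \<Rightarrow> real set" where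
  "val_lit V w (Pos a) = V w a"
| "val_lit V w (SNeg a) = {1 - upper_bd (V w a) .. 1 - lower_bd (V w a)}"

fun val :: "'a valuation \<Rightarrow> world \<Rightarrow> 'a sform \<Rightarrow> real set" where
  "val V w (Atom l) = val_lit V w l"
| "val V w (Const c) = {c..c}"
| "val V w (Conj f F G) =
     {f (lower_bd (val V w F)) (lower_bd (val V w G)) ..
      f (upper_bd (val V w F)) (upper_bd (val V w G))}"
| "val V w (Disj f F G) =
     {f (lower_bd (val V w F)) (lower_bd (val V w G)) ..
      f (upper_bd (val V w F)) (upper_bd (val V w G))}"
| "val V Here (Neg F) =
     {1 - lower_bd (val V There F) .. 1 - lower_bd (val V Here F)}"
| "val V There (Neg F) =
     {1 - lower_bd (val V There F) .. 1 - lower_bd (val V There F)}"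
| "val V Here (Impl f F G) =
     {min (f (lower_bd (val V Here F)) (lower_bd (val V Here G)))
          (f (lower_bd (val V There F)) (lower_bd (val V There G))) ..
      f (lower_bd (val V Here F)) (upper_bd (val V Here G))}"
| "val V There (Impl f F G) =
     {f (lower_bd (val V There F)) (lower_bd (val V There G)) ..
      f (lower_bd (val V There F)) (upper_bd (val V There G))}"

definition is_model :: "'a set \<Rightarrow> 'a sform \<Rightarrow> 'a valuation \<Rightarrow> bool" where
  "is_model \<sigma> F V \<longleftrightarrow> V \<in> valuations \<sigma> \<and> lower_bd (val V Here F) = 1"

definition val_le :: "'a set \<Rightarrow> 'a valuation \<Rightarrow> 'a valuation \<Rightarrow> bool" where
  "val_le \<sigma> V' V \<longleftrightarrow> (\<forall>a\<in>\<sigma>. V' There a = V There a \<and> V Here a \<subseteq> V' Here a)"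

definition val_less :: "'a set \<Rightarrow> 'a valuation \<Rightarrow> 'a valuation \<Rightarrow> bool" where
  "val_less \<sigma> V' V \<longleftrightarrow> val_le \<sigma> V' V \<and> V' \<noteq> V"

definition h_minimal_model :: "'a set \<Rightarrow> 'a sform \<Rightarrow> 'a valuation \<Rightarrow> bool" where
  "h_minimal_model \<sigma> F V \<longleftrightarrow>
     is_model \<sigma> F V \<and> \<not> (\<exists>V'. is_model \<sigma> F V' \<and> val_less \<sigma> V' V)"

definition equilibrium_model :: "'a set \<Rightarrow> 'a sform \<Rightarrow> 'a valuation \<Rightarrow> bool" where
  "equilibrium_model \<sigma> F V \<longleftrightarrow>
     h_minimal_model \<sigma> F V \<and> (\<forall>a\<in>\<sigma>. V Here a = V There a)"


section \<open>Elimination of strong negation\<close>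

text \<open>\<open>Orig p\<close> is the old atom \<open>p\<close>, and \<open>NAtom p\<close> is the new atom \<open>np\<close>.\<close>

datatype 'a natom = Orig 'a | NAtom 'a

definition ext_sig :: "'a set \<Rightarrow> 'a natom set" where
  "ext_sig \<sigma> = Orig ` \<sigma> \<union> NAtom ` \<sigma>"

fun elim_lit :: "'a literal \<Rightarrow> 'a natom" where
  "elim_lit (Pos p) = Orig p"
| "elim_lit (SNeg p) = NAtom p"

definition elim_sneg :: "'a sform \<Rightarrow> 'a natom fform" where
  "elim_sneg F = map_fform elim_lit F"

fun big_conj_m :: "'a fform list \<Rightarrow> 'a fform" where
  "big_conj_m [] = Const 1"
| "big_conj_m [F] = F"
| "big_conj_m (F # G # Fs) = Conj conj_m F (big_conj_m (G # Fs))"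

text \<open>
  A conjunction over a finite signature is, as a formula, a conjunction over an enumeration
  \<open>ps\<close> of the signature.
\<close>

definition nneg_form :: "'a list \<Rightarrow> 'a sform \<Rightarrow> 'a natom fform" where
  "nneg_form ps F =
     Conj conj_m (elim_sneg F)
       (big_conj_m (map (\<lambda>p. Neg (Conj conj_l (Atom (Orig p)) (Atom (NAtom p)))) ps))"

definition nneg_val :: "'a set \<Rightarrow> 'a valuation \<Rightarrow> 'a natom valuation" where
  "nneg_val \<sigma> V = (\<lambda>w. \<lambda>q\<in>ext_sig \<sigma>.
     (case q of Orig p \<Rightarrow> {lower_bd (V w p) .. 1} | NAtom p \<Rightarrow> {1 - upper_bd (V w p) .. 1}))"

definition interp_of :: "'a set \<Rightarrow> 'a valuation \<Rightarrow> ('a \<Rightarrow> real)" where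
  "interp_of \<tau> V = (\<lambda>q\<in>\<tau>. lower_bd (V Here q))"

end

theory Submission imports Defs begin

text \<open>
  The lower bounds of a valuation never depend on the upper bounds except through the literals, so
  a valuation carries the same information as the two interpretations of the extended signature
  (one per world) that record the lower bounds of the literals. Such interpretations are exactly
  those satisfying \<open>p + np \<le> 1\<close>, which is the condition expressed by the added constraints. The
  lower bound of \<open>F\<close> in world \<open>h\<close> is the value of the reduct of \<open>F'\<close> under the \<open>h\<close>-interpretation,
  the reduct being taken with respect to the \<open>t\<close>-interpretation. Widening the intervals of
  \<open>V(h,\<cdot>)\<close> then amounts to lowering the \<open>h\<close>-interpretation, which matches the two
  minimality conditions.
\<close>

section \<open>Connectives and values of reducts\<close>

lemma fuzzy_conj_mono:
  assumes "fuzzy_conj f" and "0 \<le> x" "x \<le> x'" "x' \<le> 1" and "0 \<le> y" "y \<le> y'" "y' \<le> 1"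
  shows "f x y \<le> f x' y'"
proof -
  have "f x y \<le> f x' y"
    using assms unfolding fuzzy_conj_def mono_on_def by auto
  also have "\<dots> \<le> f x' y'"
    using assms unfolding fuzzy_conj_def mono_on_def by auto
  finally show ?thesis .
qed

lemma fuzzy_disj_mono:
  assumes "fuzzy_disj f" and "0 \<le> x" "x \<le> x'" "x' \<le> 1" and "0 \<le> y" "y \<le> y'" "y' \<le> 1"
  shows "f x y \<le> f x' y'"
proof -
  have "f x y \<le> f x' y"
    using assms unfolding fuzzy_disj_def mono_on_def by auto
  also have "\<dots> \<le> f x' y'"
    using assms unfolding fuzzy_disj_def mono_on_def by auto
  finally show ?thesis .
qed

lemma fuzzy_impl_mono:
  assumes "fuzzy_impl f" and "0 \<le> x" "x \<le> 1" and "0 \<le> y" "y \<le> y'" "y' \<le> 1"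
  shows "f x y \<le> f x y'"
  using assms unfolding fuzzy_impl_def mono_on_def by auto

lemma fuzzy_op_unit:
  assumes "fuzzy_conj f \<or> fuzzy_disj f \<or> fuzzy_impl f" and "0 \<le> x" "x \<le> 1" "0 \<le> y" "y \<le> 1"
  shows "0 \<le> f x y" and "f x y \<le> 1"
  using assms unfolding fuzzy_conj_def fuzzy_disj_def fuzzy_impl_def fuzzy_op_def by auto

lemma eval_form_unit:
  assumes "I \<in> interpretations \<tau>" and "fuzzy_formula \<tau> F"
  shows "0 \<le> eval_form I F \<and> eval_form I F \<le> 1"
  using assms(2)
proof (induction F)
  case (Atom p)
  then show ?case using assms(1) by (auto simp: interpretations_def PiE_iff)
next
  case (Conj f F G)
  then show ?case using fuzzy_op_unit[of f "eval_form I F" "eval_form I G"] by simp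
next
  case (Disj f F G)
  then show ?case using fuzzy_op_unit[of f "eval_form I F" "eval_form I G"] by simp
next
  case (Impl f F G)
  then show ?case using fuzzy_op_unit[of f "eval_form I F" "eval_form I G"] by simp
qed simp_all

text \<open>The reduct caps every compound formula by its value under \<open>I\<close>, so the upper
  bound is immediate even below implications, which are antitone in the antecedent. Nonnegativity
  needs the induction: subvalues stay in the unit interval, where connectives take values in
  it.\<close>

lemma eval_reduct_bounds:
  assumes "I \<in> interpretations \<tau>" and "J \<in> interpretations \<tau>" and "\<forall>p\<in>\<tau>. J p \<le> I p"
    and "fuzzy_formula \<tau> F"
  shows "0 \<le> eval_form J (reduct I F) \<and> eval_form J (reduct I F) \<le> eval_form I F"
  using assms(4)
proof (induction F)
  case (Atom p)
  then show ?case using assms by (auto simp: interpretations_def PiE_iff)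
next
  case (Neg F)
  then show ?case using eval_form_unit[OF assms(1), of F] by auto
next
  case (Conj f F G)
  then have "0 \<le> f (eval_form J (reduct I F)) (eval_form J (reduct I G))"
    using eval_form_unit[OF assms(1), of F] eval_form_unit[OF assms(1), of G]
    by (intro fuzzy_op_unit(1)[of f]) auto
  moreover have "0 \<le> eval_form I (Conj f F G)"
    using eval_form_unit[OF assms(1) Conj.prems] by simp
  ultimately show ?case by (simp add: conj_m_def)
next
  case (Disj f F G)
  then have "0 \<le> f (eval_form J (reduct I F)) (eval_form J (reduct I G))"
    using eval_form_unit[OF assms(1), of F] eval_form_unit[OF assms(1), of G]
    by (intro fuzzy_op_unit(1)[of f]) auto
  moreover have "0 \<le> eval_form I (Disj f F G)"
    using eval_form_unit[OF assms(1) Disj.prems] by simp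
  ultimately show ?case by (simp add: conj_m_def)
next
  case (Impl f F G)
  then have "0 \<le> f (eval_form J (reduct I F)) (eval_form J (reduct I G))"
    using eval_form_unit[OF assms(1), of F] eval_form_unit[OF assms(1), of G]
    by (intro fuzzy_op_unit(1)[of f]) auto
  moreover have "0 \<le> eval_form I (Impl f F G)"
    using eval_form_unit[OF assms(1) Impl.prems] by simp
  ultimately show ?case by (simp add: conj_m_def)
qed simp

text \<open>At \<open>J = I\<close> each cap coincides with the value it caps.\<close>

lemma eval_reduct_self: "eval_form I (reduct I F) = eval_form I F"
  by (induction F) (auto simp: conj_m_def)

lemma fuzzy_formula_map:
  "fuzzy_formula \<tau> F \<Longrightarrow> fuzzy_formula (g ` \<tau>) (map_fform g F)"
  by (induction F) auto

lemma fuzzy_formula_elim_sneg: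
  assumes "fuzzy_formula (literals \<sigma>) F"
  shows "fuzzy_formula (ext_sig \<sigma>) (elim_sneg F)"
proof -
  have "elim_lit ` literals \<sigma> = ext_sig \<sigma>"
    by (auto simp: literals_def ext_sig_def image_Un image_image)
  then show ?thesis
    using fuzzy_formula_map[OF assms, of elim_lit] by (simp add: elim_sneg_def)
qed

section \<open>Interval assignments as coherent interpretations\<close>

text \<open>Nonemptiness of the intervals \<open>{I (Orig p)..1 - I (NAtom p)}\<close>.\<close>

definition coherent :: "'a set \<Rightarrow> ('a natom \<Rightarrow> real) \<Rightarrow> bool" where
  "coherent \<sigma> I \<longleftrightarrow> (\<forall>p\<in>\<sigma>. I (Orig p) + I (NAtom p) \<le> 1)"

text \<open>Takes a single world, so that \<open>V Here\<close> and \<open>V There\<close> are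
  encoded separately; \<open>interval_of\<close> is its inverse on coherent interpretations.\<close>

definition lower_of :: "'a set \<Rightarrow> ('a \<Rightarrow> real set) \<Rightarrow> 'a natom \<Rightarrow> real" where
  "lower_of \<sigma> A = (\<lambda>q\<in>ext_sig \<sigma>. case q of Orig p \<Rightarrow> Inf (A p) | NAtom p \<Rightarrow> 1 - Sup (A p))"

definition interval_of :: "'a set \<Rightarrow> ('a natom \<Rightarrow> real) \<Rightarrow> 'a \<Rightarrow> real set" where
  "interval_of \<sigma> I = (\<lambda>p\<in>\<sigma>. {I (Orig p)..1 - I (NAtom p)})"

lemma unit_intervals_bounds:
  assumes "A \<in> unit_intervals"
  shows "0 \<le> Inf A" "Inf A \<le> Sup A" "Sup A \<le> 1"
  using assms by (auto simp: unit_intervals_def)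

lemma unit_intervals_Icc: "A \<in> unit_intervals \<Longrightarrow> {Inf A..Sup A} = A"
  by (auto simp: unit_intervals_def)

lemma unit_intervals_iff: "l \<le> u \<Longrightarrow> {l..u} \<in> unit_intervals \<longleftrightarrow> 0 \<le> l \<and> u \<le> (1::real)"
  by (auto simp: unit_intervals_def Icc_eq_Icc)

lemma in_ext_sig [simp]:
  "Orig p \<in> ext_sig \<sigma> \<longleftrightarrow> p \<in> \<sigma>" "NAtom p \<in> ext_sig \<sigma> \<longleftrightarrow> p \<in> \<sigma>"
  by (auto simp: ext_sig_def)

lemma ball_ext_sig:
  "(\<forall>q\<in>ext_sig \<sigma>. P q) \<longleftrightarrow> (\<forall>p\<in>\<sigma>. P (Orig p) \<and> P (NAtom p))"
  by (auto simp: ext_sig_def)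

lemma lower_of_simps [simp]:
  "p \<in> \<sigma> \<Longrightarrow> lower_of \<sigma> A (Orig p) = Inf (A p)"
  "p \<in> \<sigma> \<Longrightarrow> lower_of \<sigma> A (NAtom p) = 1 - Sup (A p)"
  by (auto simp: lower_of_def)

lemma interpretations_iff:
  "I \<in> interpretations \<tau> \<longleftrightarrow> (\<forall>q\<in>\<tau>. 0 \<le> I q \<and> I q \<le> 1) \<and> I \<in> extensional \<tau>"
  by (auto simp: interpretations_def PiE_iff)

lemma lower_of_interpretation:
  assumes "A \<in> \<sigma> \<rightarrow>\<^sub>E unit_intervals"
  shows "lower_of \<sigma> A \<in> interpretations (ext_sig \<sigma>)"
proof -
  have "0 \<le> Inf (A p) \<and> Inf (A p) \<le> 1 \<and> 0 \<le> Sup (A p) \<and> Sup (A p) \<le> 1" if "p \<in> \<sigma>" for p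
    using unit_intervals_bounds[OF PiE_mem[OF assms that]] by linarith
  then show ?thesis
    unfolding interpretations_iff ball_ext_sig by (auto simp: lower_of_def)
qed

lemma coherent_lower_of:
  assumes "A \<in> \<sigma> \<rightarrow>\<^sub>E unit_intervals"
  shows "coherent \<sigma> (lower_of \<sigma> A)"
proof -
  have "Inf (A p) \<le> Sup (A p)" if "p \<in> \<sigma>" for p
    using unit_intervals_bounds[OF PiE_mem[OF assms that]] by blast
  then show ?thesis by (auto simp: coherent_def)
qed

lemma interval_of_lower_of:
  assumes "A \<in> \<sigma> \<rightarrow>\<^sub>E unit_intervals"
  shows "interval_of \<sigma> (lower_of \<sigma> A) = A"
proof
  fix p
  show "interval_of \<sigma> (lower_of \<sigma> A) p = A p"
  proof (cases "p \<in> \<sigma>")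
    case True
    then show ?thesis
      using unit_intervals_Icc[OF PiE_mem[OF assms True]] by (simp add: interval_of_def)
  next
    case False
    then show ?thesis using PiE_arb[OF assms False] by (simp add: interval_of_def)
  qed
qed

lemma interval_of_mem:
  assumes "I \<in> interpretations (ext_sig \<sigma>)" and "coherent \<sigma> I"
  shows "interval_of \<sigma> I \<in> \<sigma> \<rightarrow>\<^sub>E unit_intervals"
proof (rule PiE_I)
  fix p assume "p \<in> \<sigma>"
  moreover from this have "I (Orig p) \<le> 1 - I (NAtom p)"
    using assms(2) by (auto simp: coherent_def)
  ultimately show "interval_of \<sigma> I p \<in> unit_intervals"
    using assms(1) unfolding interpretations_iff ball_ext_sig
    by (auto simp: interval_of_def unit_intervals_iff)
qed (simp add: interval_of_def)

lemma lower_of_interval_of: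
  assumes "I \<in> interpretations (ext_sig \<sigma>)" and "coherent \<sigma> I"
  shows "lower_of \<sigma> (interval_of \<sigma> I) = I"
proof
  fix q
  show "lower_of \<sigma> (interval_of \<sigma> I) q = I q"
  proof (cases "q \<in> ext_sig \<sigma>")
    case True
    then obtain p where p: "p \<in> \<sigma>" and q: "q = Orig p \<or> q = NAtom p"
      by (auto simp: ext_sig_def)
    then have "I (Orig p) \<le> 1 - I (NAtom p)"
      using assms(2) by (auto simp: coherent_def)
    with p q show ?thesis by (auto simp: interval_of_def)
  next
    case False
    then show ?thesis
      using assms(1) by (auto simp: lower_of_def interpretations_iff extensional_def)
  qed
qed

text \<open>Widening an interval lowers \<open>Inf\<close> and raises \<open>Sup\<close>, hence
  lowers both coordinates \<open>Inf\<close> and \<open>1 - Sup\<close>.\<close>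

lemma subset_iff_lower_of_le:
  assumes "A \<in> \<sigma> \<rightarrow>\<^sub>E unit_intervals" and "B \<in> \<sigma> \<rightarrow>\<^sub>E unit_intervals"
  shows "(\<forall>p\<in>\<sigma>. B p \<subseteq> A p) \<longleftrightarrow> (\<forall>q\<in>ext_sig \<sigma>. lower_of \<sigma> A q \<le> lower_of \<sigma> B q)"
proof -
  have "B p \<subseteq> A p \<longleftrightarrow> Inf (A p) \<le> Inf (B p) \<and> Sup (B p) \<le> Sup (A p)" if p: "p \<in> \<sigma>" for p
  proof -
    obtain l u where "A p = {l..u}" "l \<le> u"
      using PiE_mem[OF assms(1) p] by (auto simp: unit_intervals_def)
    moreover obtain l' u' where "B p = {l'..u'}" "l' \<le> u'"
      using PiE_mem[OF assms(2) p] by (auto simp: unit_intervals_def)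
    ultimately show ?thesis by auto
  qed
  then show ?thesis unfolding ball_ext_sig by auto
qed

lemma interp_of_nneg_val:
  assumes "V \<in> valuations \<sigma>"
  shows "interp_of (ext_sig \<sigma>) (nneg_val \<sigma> V) = lower_of \<sigma> (V Here)"
proof
  fix q
  show "interp_of (ext_sig \<sigma>) (nneg_val \<sigma> V) q = lower_of \<sigma> (V Here) q"
  proof (cases "q \<in> ext_sig \<sigma>")
    case True
    then obtain p where p: "p \<in> \<sigma>" and q: "q = Orig p \<or> q = NAtom p"
      by (auto simp: ext_sig_def)
    have "V Here p \<in> unit_intervals" using assms p by (auto simp: valuations_def)
    \<comment> \<open>These make the intervals of \<open>nneg_val\<close> nonempty, so that their
      infima are their left endpoints.\<close>
    then have "Inf (V Here p) \<le> 1" "0 \<le> Sup (V Here p)"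
      using unit_intervals_bounds by (blast intro: order_trans)+
    with p q show ?thesis by (auto simp: interp_of_def nneg_val_def)
  next
    case False
    then show ?thesis by (simp add: interp_of_def lower_of_def)
  qed
qed

section \<open>Lower bounds of formulas are values of reducts\<close>

text \<open>The claims are proved jointly because a left endpoint is the infimum only of a nonempty
  interval. Under negation, the reduct's constant is the \<open>There\<close> value; under
  implication, its cap is the second argument of \<open>min\<close> in the semantics.\<close>

lemma val_bounds:
  assumes V: "V \<in> valuations \<sigma>" and F: "fuzzy_formula (literals \<sigma>) F"
  defines "I \<equiv> lower_of \<sigma> (V There)" and "J \<equiv> lower_of \<sigma> (V Here)"
  shows "val V Here F \<in> unit_intervals \<and> val V There F \<in> unit_intervals \<and>
    Inf (val V Here F) = eval_form J (reduct I (elim_sneg F)) \<and>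
    Inf (val V There F) = eval_form I (elim_sneg F)"
proof -
  have VE: "V w \<in> \<sigma> \<rightarrow>\<^sub>E unit_intervals" for w
    using V by (auto simp: valuations_def)
  have I: "I \<in> interpretations (ext_sig \<sigma>)" and J: "J \<in> interpretations (ext_sig \<sigma>)"
    unfolding I_def J_def by (rule lower_of_interpretation[OF VE])+
  have JI: "\<forall>q\<in>ext_sig \<sigma>. J q \<le> I q"
    using V subset_iff_lower_of_le[OF VE VE, of There Here]
    by (auto simp: I_def J_def valuations_def)
  \<comment> \<open>With the induction hypotheses this says that lower bounds do not decrease from
    \<open>Here\<close> to \<open>There\<close>.\<close>
  have le: "eval_form J (reduct I (elim_sneg G)) \<le> eval_form I (elim_sneg G)"
    if "fuzzy_formula (literals \<sigma>) G" for G
    using eval_reduct_bounds[OF I J JI fuzzy_formula_elim_sneg[OF that]] by simp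
  show ?thesis using F
  proof (induction F)
    case (Atom l)
    obtain p where p: "p \<in> \<sigma>" and l: "l = Pos p \<or> l = SNeg p"
      using Atom by (auto simp: literals_def)
    have *: "0 \<le> Inf (V w p)" "Inf (V w p) \<le> Sup (V w p)" "Sup (V w p) \<le> 1" for w
      using unit_intervals_bounds[OF PiE_mem[OF VE[of w] p]] .
    have "V w p \<in> unit_intervals" "{1 - Sup (V w p)..1 - Inf (V w p)} \<in> unit_intervals" for w
      using PiE_mem[OF VE[of w] p] *[of w] by (auto simp: unit_intervals_iff)
    with l p * show ?case by (auto simp: I_def J_def elim_sneg_def)
  next
    case (Const c)
    then show ?case using unit_intervals_iff[of c c] by (auto simp: elim_sneg_def)
  next
    case (Neg F)
    then have *: "val V Here F \<in> unit_intervals" "val V There F \<in> unit_intervals"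
      "Inf (val V Here F) \<le> Inf (val V There F)"
      using le[of F] by auto
    then have "Inf (val V There F) \<le> 1" "0 \<le> Inf (val V Here F)"
      using unit_intervals_bounds order_trans by blast+
    with * have "{1 - Inf (val V There F)..1 - Inf (val V Here F)} \<in> unit_intervals"
      "{1 - Inf (val V There F)..1 - Inf (val V There F)} \<in> unit_intervals"
      by (subst unit_intervals_iff; linarith)+
    with * Neg show ?case by (simp add: elim_sneg_def)
  next
    case (Conj f F G)
    then have f: "fuzzy_conj f" by simp
    let ?a = "\<lambda>w. f (Inf (val V w F)) (Inf (val V w G))"
    let ?b = "\<lambda>w. f (Sup (val V w F)) (Sup (val V w G))"
    have "val V w F \<in> unit_intervals" "val V w G \<in> unit_intervals" for w
      using Conj by (cases w; simp)+
    then have b: "0 \<le> Inf (val V w F)" "Inf (val V w F) \<le> Sup (val V w F)" "Sup (val V w F) \<le> 1"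
      "0 \<le> Inf (val V w G)" "Inf (val V w G) \<le> Sup (val V w G)" "Sup (val V w G) \<le> 1" for w
      using unit_intervals_bounds by blast+
    have ab: "0 \<le> ?a w" "?a w \<le> ?b w" "?b w \<le> 1" for w
      using b[of w] f fuzzy_op_unit(1)[of f "Inf (val V w F)" "Inf (val V w G)"]
        fuzzy_op_unit(2)[of f "Sup (val V w F)" "Sup (val V w G)"]
      by (auto intro: fuzzy_conj_mono[of f])
    \<comment> \<open>The semantic clause has no minimum here; this inequality makes the cap in the
      reduct inactive.\<close>
    have "?a Here \<le> ?a There"
    proof (rule fuzzy_conj_mono[OF f])
      show "Inf (val V Here F) \<le> Inf (val V There F)" "Inf (val V Here G) \<le> Inf (val V There G)"
        using le[of F] le[of G] Conj by simp_all
      show "0 \<le> Inf (val V Here F)" "0 \<le> Inf (val V Here G)"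
        using b by blast+
      show "Inf (val V There F) \<le> 1" "Inf (val V There G) \<le> 1"
        using b by (blast intro: order_trans)+
    qed
    with ab[of Here] ab[of There] Conj show ?case
      by (simp add: unit_intervals_iff elim_sneg_def conj_m_def)
  next
    case (Disj f F G)
    then have f: "fuzzy_disj f" by simp
    let ?a = "\<lambda>w. f (Inf (val V w F)) (Inf (val V w G))"
    let ?b = "\<lambda>w. f (Sup (val V w F)) (Sup (val V w G))"
    have "val V w F \<in> unit_intervals" "val V w G \<in> unit_intervals" for w
      using Disj by (cases w; simp)+
    then have b: "0 \<le> Inf (val V w F)" "Inf (val V w F) \<le> Sup (val V w F)" "Sup (val V w F) \<le> 1"
      "0 \<le> Inf (val V w G)" "Inf (val V w G) \<le> Sup (val V w G)" "Sup (val V w G) \<le> 1" for w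
      using unit_intervals_bounds by blast+
    have ab: "0 \<le> ?a w" "?a w \<le> ?b w" "?b w \<le> 1" for w
      using b[of w] f fuzzy_op_unit(1)[of f "Inf (val V w F)" "Inf (val V w G)"]
        fuzzy_op_unit(2)[of f "Sup (val V w F)" "Sup (val V w G)"]
      by (auto intro: fuzzy_disj_mono[of f])
    \<comment> \<open>As for conjunction, the cap is inactive by monotonicity.\<close>
    have "?a Here \<le> ?a There"
    proof (rule fuzzy_disj_mono[OF f])
      show "Inf (val V Here F) \<le> Inf (val V There F)" "Inf (val V Here G) \<le> Inf (val V There G)"
        using le[of F] le[of G] Disj by simp_all
      show "0 \<le> Inf (val V Here F)" "0 \<le> Inf (val V Here G)"
        using b by blast+
      show "Inf (val V There F) \<le> 1" "Inf (val V There G) \<le> 1"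
        using b by (blast intro: order_trans)+
    qed
    with ab[of Here] ab[of There] Disj show ?case
      by (simp add: unit_intervals_iff elim_sneg_def conj_m_def)
  next
    case (Impl f F G)
    then have f: "fuzzy_impl f" by simp
    let ?a = "\<lambda>w. f (Inf (val V w F)) (Inf (val V w G))"
    \<comment> \<open>Both endpoints share the antecedent value, so \<open>?a w \<le> ?b w\<close>
      rests on monotonicity in the consequent.\<close>
    let ?b = "\<lambda>w. f (Inf (val V w F)) (Sup (val V w G))"
    have "val V w F \<in> unit_intervals" "val V w G \<in> unit_intervals" for w
      using Impl by (cases w; simp)+
    then have b: "0 \<le> Inf (val V w F)" "Inf (val V w F) \<le> Sup (val V w F)" "Sup (val V w F) \<le> 1"
      "0 \<le> Inf (val V w G)" "Inf (val V w G) \<le> Sup (val V w G)" "Sup (val V w G) \<le> 1" for w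
      using unit_intervals_bounds by blast+
    have ab: "0 \<le> ?a w" "?a w \<le> ?b w" "?b w \<le> 1" for w
      using b[of w] f fuzzy_op_unit(1)[of f "Inf (val V w F)" "Inf (val V w G)"]
        fuzzy_op_unit(2)[of f "Inf (val V w F)" "Sup (val V w G)"]
      by (auto intro: fuzzy_impl_mono[of f])
    \<comment> \<open>Antitonicity in the antecedent prevents comparing \<open>?a Here\<close> with
      \<open>?a There\<close>; the minimum stays and matches the cap.\<close>
    have "min (?a Here) (?a There) \<le> ?b Here" "0 \<le> min (?a Here) (?a There)"
      using ab(2)[of Here] ab(1)[of Here] ab(1)[of There] by (auto simp: min_le_iff_disj)
    with ab[of Here] ab[of There] Impl show ?case
      by (simp add: unit_intervals_iff elim_sneg_def conj_m_def)
  qed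
qed

lemma is_model_iff:
  assumes "V \<in> valuations \<sigma>" and "fuzzy_formula (literals \<sigma>) F"
  shows "is_model \<sigma> F V \<longleftrightarrow>
    satisfies (lower_of \<sigma> (V Here)) (reduct (lower_of \<sigma> (V There)) (elim_sneg F))"
  using val_bounds[OF assms] assms(1) by (simp add: is_model_def satisfies_def)

section \<open>The coherence constraints\<close>

text \<open>The bound by 1 is proved alongside because the equivalence uses it for the tail of the
  list.\<close>

lemma eval_big_conj_m_eq_1:
  assumes "\<forall>G\<in>set Gs. eval_form I G \<le> 1"
  shows "eval_form I (big_conj_m Gs) = 1 \<longleftrightarrow> (\<forall>G\<in>set Gs. eval_form I G = 1)"
    and "eval_form I (big_conj_m Gs) \<le> 1"
  using assms by (induction Gs rule: big_conj_m.induct) (auto simp: conj_m_def min_def)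

text \<open>The reduct freezes each negation at its value under \<open>I\<close>, so no atom is left
  for \<open>J\<close> to evaluate.\<close>

lemma eval_reduct_big_conj_m_Neg:
  "eval_form J (reduct I (big_conj_m (map (\<lambda>p. Neg (G p)) ps))) =
    eval_form I (big_conj_m (map (\<lambda>p. Neg (G p)) ps))"
proof (induction ps)
  case (Cons p ps)
  then show ?case by (cases ps) (auto simp: conj_m_def)
qed simp

lemma min_eq_1_iff: "a \<le> 1 \<Longrightarrow> b \<le> 1 \<Longrightarrow> min a b = (1::real) \<longleftrightarrow> a = 1 \<and> b = 1"
  by (auto simp: min_def)

lemma satisfies_nneg_form:
  assumes "fuzzy_formula (literals (set ps)) F" and "I \<in> interpretations (ext_sig (set ps))"
  shows "satisfies I (nneg_form ps F) \<longleftrightarrow> satisfies I (elim_sneg F) \<and> coherent (set ps) I"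
proof -
  let ?C = "\<lambda>p. Neg (Conj conj_l (Atom (Orig p)) (Atom (NAtom p)))"
  have le: "\<forall>G\<in>set (map ?C ps). eval_form I G \<le> 1"
    by (simp add: conj_l_def)
  have "eval_form I (elim_sneg F) \<le> 1"
    using eval_form_unit[OF assms(2) fuzzy_formula_elim_sneg[OF assms(1)]] by simp
  moreover have "eval_form I (?C p) = 1 \<longleftrightarrow> I (Orig p) + I (NAtom p) \<le> 1" for p
    by (simp add: conj_l_def max_def)
  moreover have "eval_form I (big_conj_m (map ?C ps)) = 1 \<longleftrightarrow>
      (\<forall>p\<in>set ps. eval_form I (?C p) = 1)"
    using eval_big_conj_m_eq_1(1)[OF le] by (simp only: set_map ball_simps)
  ultimately have "eval_form I (nneg_form ps F) = 1 \<longleftrightarrow>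
      eval_form I (elim_sneg F) = 1 \<and> (\<forall>p\<in>set ps. I (Orig p) + I (NAtom p) \<le> 1)"
    using min_eq_1_iff[OF _ eval_big_conj_m_eq_1(2)[OF le]]
    by (simp only: nneg_form_def eval_form.simps(4) conj_m_def)
  then show ?thesis by (simp only: satisfies_def coherent_def)
qed

lemma satisfies_reduct_nneg_form:
  assumes "satisfies I (nneg_form ps F)"
    and "eval_form J (reduct I (elim_sneg F)) \<le> 1"
  shows "satisfies J (reduct I (nneg_form ps F)) \<longleftrightarrow> satisfies J (reduct I (elim_sneg F))"
proof -
  let ?B = "big_conj_m (map (\<lambda>p. Neg (Conj conj_l (Atom (Orig p)) (Atom (NAtom p)))) ps)"
  have "min (eval_form I (elim_sneg F)) (eval_form I ?B) = 1"
    using assms(1) by (simp only: satisfies_def nneg_form_def eval_form.simps(4) conj_m_def)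
  moreover from this have "1 \<le> eval_form I ?B" by linarith
  ultimately show ?thesis
    using assms(2) eval_reduct_big_conj_m_Neg[of J I _ ps]
    by (simp only: satisfies_def nneg_form_def reduct.simps(4) eval_form.simps(2,4) conj_m_def
        min.absorb1[of "eval_form J (reduct I (elim_sneg F))" "eval_form I ?B"])
      (simp add: min_def)
qed

text \<open>The constraints test only the candidate \<open>I\<close>; competitors below
  \<open>I\<close> face the same reduct condition with and without them.\<close>

lemma stable_model_nneg_form_iff:
  assumes F: "fuzzy_formula (literals (set ps)) F" and I: "I \<in> interpretations (ext_sig (set ps))"
  shows "stable_model (ext_sig (set ps)) (nneg_form ps F) I \<longleftrightarrow>
    coherent (set ps) I \<and> stable_model (ext_sig (set ps)) (elim_sneg F) I"
proof -
  have "satisfies J (reduct I (nneg_form ps F)) \<longleftrightarrow> satisfies J (reduct I (elim_sneg F))"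
    if "satisfies I (nneg_form ps F)" "J \<in> interpretations (ext_sig (set ps))"
      "\<forall>q\<in>ext_sig (set ps). J q \<le> I q" for J
    using satisfies_reduct_nneg_form[OF that(1), of J]
      eval_reduct_bounds[OF I that(2,3) fuzzy_formula_elim_sneg[OF F]]
      eval_form_unit[OF I fuzzy_formula_elim_sneg[OF F]] by simp
  then show ?thesis
    unfolding stable_model_def using satisfies_nneg_form[OF F I] by blast
qed

section \<open>Equilibrium models and stable models\<close>

text \<open>Competitors \<open>V'\<close> of \<open>V\<close> share its \<open>There\<close> world,
  hence the reduct, and correspond to interpretations \<open>J\<close> below
  \<open>I\<close>.\<close>

lemma h_minimal_model_iff_stable_model:
  assumes V: "V \<in> valuations \<sigma>" and HT: "V Here = V There"
    and F: "fuzzy_formula (literals \<sigma>) F"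
  shows "h_minimal_model \<sigma> F V \<longleftrightarrow>
    stable_model (ext_sig \<sigma>) (elim_sneg F) (lower_of \<sigma> (V Here))"
proof -
  define I where "I = lower_of \<sigma> (V There)"
  have VE: "V w \<in> \<sigma> \<rightarrow>\<^sub>E unit_intervals" for w
    using V by (auto simp: valuations_def)
  have I: "I \<in> interpretations (ext_sig \<sigma>)" "coherent \<sigma> I"
    unfolding I_def using VE by (auto intro: lower_of_interpretation coherent_lower_of)
  have model: "is_model \<sigma> F V \<longleftrightarrow> satisfies I (elim_sneg F)"
    using is_model_iff[OF V F] by (simp add: HT I_def satisfies_def eval_reduct_self)
  have "(\<exists>V'. is_model \<sigma> F V' \<and> val_less \<sigma> V' V) \<longleftrightarrow>
    (\<exists>J\<in>interpretations (ext_sig \<sigma>). J \<noteq> I \<and> (\<forall>q\<in>ext_sig \<sigma>. J q \<le> I q) \<and>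
      satisfies J (reduct I (elim_sneg F)))" (is "?L \<longleftrightarrow> ?R")
  proof
    assume ?L
    then obtain V' where m: "is_model \<sigma> F V'" and le: "val_le \<sigma> V' V" and "V' \<noteq> V"
      by (auto simp: val_less_def)
    then have V': "V' \<in> valuations \<sigma>" by (simp add: is_model_def)
    then have VE': "V' w \<in> \<sigma> \<rightarrow>\<^sub>E unit_intervals" for w by (auto simp: valuations_def)
    have T: "V' There = V There"
      using le by (intro PiE_ext[OF VE' VE]) (simp add: val_le_def)
    \<comment> \<open>The worlds \<open>There\<close> agree, so the difference lies in
      \<open>Here\<close>, where \<open>lower_of\<close> is injective.\<close>
    have "V' Here \<noteq> V Here"
    proof
      assume "V' Here = V Here"
      with T have "V' w = V w" for w by (cases w) auto
      with \<open>V' \<noteq> V\<close> show False by auto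
    qed
    then have "lower_of \<sigma> (V' Here) \<noteq> I"
      using interval_of_lower_of[OF VE'[of Here]] interval_of_lower_of[OF VE[of Here]]
      by (auto simp: I_def HT)
    moreover have "\<forall>q\<in>ext_sig \<sigma>. lower_of \<sigma> (V' Here) q \<le> I q"
      using le subset_iff_lower_of_le[OF VE' VE, of Here Here]
      by (auto simp: I_def HT val_le_def)
    moreover have "satisfies (lower_of \<sigma> (V' Here)) (reduct I (elim_sneg F))"
      using m is_model_iff[OF V' F] T by (simp add: I_def)
    ultimately show ?R using lower_of_interpretation[OF VE'] by blast
  next
    assume ?R
    then obtain J where J: "J \<in> interpretations (ext_sig \<sigma>)" and "J \<noteq> I"
      and le: "\<forall>q\<in>ext_sig \<sigma>. J q \<le> I q" and s: "satisfies J (reduct I (elim_sneg F))"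
      by blast
    \<comment> \<open>Coherence is inherited downwards, so every competitor \<open>J\<close> encodes
      genuine intervals.\<close>
    have coh: "coherent \<sigma> J"
      unfolding coherent_def
    proof
      fix p assume "p \<in> \<sigma>"
      then have "J (Orig p) \<le> I (Orig p)" "J (NAtom p) \<le> I (NAtom p)"
        "I (Orig p) + I (NAtom p) \<le> 1"
        using le I(2) by (auto simp: coherent_def)
      then show "J (Orig p) + J (NAtom p) \<le> 1" by linarith
    qed
    define V' where "V' = V(Here := interval_of \<sigma> J)"
    have lower: "lower_of \<sigma> (V' Here) = J"
      using lower_of_interval_of[OF J coh] by (simp add: V'_def)
    have T: "V' There = V There" by (simp add: V'_def)
    have VE': "V' w \<in> \<sigma> \<rightarrow>\<^sub>E unit_intervals" for w
      using VE interval_of_mem[OF J coh] by (auto simp: V'_def)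
    have sub: "\<forall>p\<in>\<sigma>. V Here p \<subseteq> V' Here p"
      using subset_iff_lower_of_le[OF VE' VE, of Here Here] le by (simp add: lower I_def HT)
    \<comment> \<open>The nesting of worlds in \<open>V'\<close> is exactly \<open>sub\<close>,
      since \<open>V' There = V There = V Here\<close>.\<close>
    then have V': "V' \<in> valuations \<sigma>"
      using VE' HT T by (auto simp: valuations_def)
    have "is_model \<sigma> F V'"
      using is_model_iff[OF V' F] s by (simp add: lower T I_def)
    moreover have "V' \<noteq> V"
      using lower \<open>J \<noteq> I\<close> by (auto simp: I_def HT)
    ultimately show ?L
      using sub T by (intro exI[of _ V']) (auto simp: val_less_def val_le_def)
  qed
  then show ?thesis
    using I(1) model by (simp add: h_minimal_model_def stable_model_def HT I_def)
qed

lemma equilibrium_model_iff_stable_model: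
  assumes V: "V \<in> valuations (set ps)" and F: "fuzzy_formula (literals (set ps)) F"
  shows "equilibrium_model (set ps) F V \<longleftrightarrow>
    (\<forall>p\<in>set ps. V Here p = V There p) \<and>
    stable_model (ext_sig (set ps)) (nneg_form ps F) (lower_of (set ps) (V Here))"
proof -
  have VE: "V w \<in> set ps \<rightarrow>\<^sub>E unit_intervals" for w
    using V by (auto simp: valuations_def)
  \<comment> \<open>Extensionality upgrades agreement on the signature to equality of
    functions.\<close>
  have "V Here = V There" if "\<forall>p\<in>set ps. V Here p = V There p"
    using that by (intro PiE_ext[OF VE VE]) simp
  then show ?thesis
    using h_minimal_model_iff_stable_model[OF V _ F]
      stable_model_nneg_form_iff[OF F lower_of_interpretation[OF VE]] coherent_lower_of[OF VE]
    unfolding equilibrium_model_def by metis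
qed

theorem theorem7:
  fixes \<sigma> :: "'a set" and ps :: "'a list" and F :: "'a sform"
  assumes "finite \<sigma>"
    and "distinct ps" and "set ps = \<sigma>"
    and "fuzzy_formula (literals \<sigma>) F"
  shows "(\<forall>V \<in> valuations \<sigma>.
            equilibrium_model \<sigma> F V \<longleftrightarrow>
              (\<forall>p\<in>\<sigma>. V Here p = V There p) \<and>
              stable_model (ext_sig \<sigma>) (nneg_form ps F) (interp_of (ext_sig \<sigma>) (nneg_val \<sigma> V)))
       \<and> (\<forall>I \<in> interpretations (ext_sig \<sigma>).
            stable_model (ext_sig \<sigma>) (nneg_form ps F) I \<longleftrightarrow>
              (\<exists>V. equilibrium_model \<sigma> F V \<and> I = interp_of (ext_sig \<sigma>) (nneg_val \<sigma> V)))"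
proof -
  note F = assms(4)[folded assms(3)]
  have a: "equilibrium_model \<sigma> F V \<longleftrightarrow>
      (\<forall>p\<in>\<sigma>. V Here p = V There p) \<and>
      stable_model (ext_sig \<sigma>) (nneg_form ps F) (interp_of (ext_sig \<sigma>) (nneg_val \<sigma> V))"
    if "V \<in> valuations \<sigma>" for V
    using equilibrium_model_iff_stable_model[of V ps F, unfolded assms(3), OF that assms(4)]
    unfolding interp_of_nneg_val[OF that] .
  have "\<exists>V. equilibrium_model \<sigma> F V \<and> I = interp_of (ext_sig \<sigma>) (nneg_val \<sigma> V)"
    if I: "I \<in> interpretations (ext_sig \<sigma>)" and st: "stable_model (ext_sig \<sigma>) (nneg_form ps F) I"
    for I
  proof -
    \<comment> \<open>Coherence comes from the added constraints and makes \<open>I\<close>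
      decodable into intervals.\<close>
    have coh: "coherent \<sigma> I"
      using stable_model_nneg_form_iff[OF F, of I] I st by (simp add: assms(3))
    \<comment> \<open>Both worlds receive the decoded intervals, as an equilibrium model requires;
      \<open>a\<close> then transfers stability.\<close>
    define V :: "'a valuation" where "V = (\<lambda>w. interval_of \<sigma> I)"
    have V: "V \<in> valuations \<sigma>"
      using interval_of_mem[OF I coh] by (auto simp: V_def valuations_def)
    have eq: "I = interp_of (ext_sig \<sigma>) (nneg_val \<sigma> V)"
      using interp_of_nneg_val[OF V] lower_of_interval_of[OF I coh] by (simp add: V_def)
    have "equilibrium_model \<sigma> F V"
      using st a[OF V] unfolding eq[symmetric] by (simp add: V_def)
    with eq show ?thesis by blast
  qed
  \<comment> \<open>Allows \<open>a\<close> to be applied to an arbitrary equilibrium model in the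
    converse of the second claim.\<close>
  moreover have "V \<in> valuations \<sigma>" if "equilibrium_model \<sigma> F V" for V
    using that by (simp add: equilibrium_model_def h_minimal_model_def is_model_def)
  ultimately show ?thesis using a by blast
qed

end
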